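(* Every thermodynamically admissible one-step scheme satisfies $$\mathcal F_h[u_h^{n+1}]-\mathcal F_h[u_h^n]=-\tau_n\mathcal D_{h,\tau}^{\,n+\frac12}+\tau_n\mathcal B_{h,\tau}^{\,n+\frac12}+\tau_n\mathcal S_{h,\tau}^{\,n+\frac12},$$ where $$\mathcal B_{h,\tau}^{\,n+\frac12}:=\mathcal B_{h,\tau}^{\mathrm{rev},\,n+\frac12}+\mathcal B_{h,\tau}^{\mathrm{diss},\,n+\frac12}+\mathcal B_{h,\tau}^{\mathrm{ext},\,n+\frac12}.$$
   Context: $\Omega\subset\mathbb R^d$ is a bounded Lipschitz domain; $V\hookrightarrow L^2(\Omega;\mathbb R^m)$ is a reflexive Banach space; $V_h\subset V$ is finite-dimensional; $\mathcal F_h$ is a real-valued discrete free-energy functional on states in $V_h$. Let $0=t^0<t^1<\cdots<t^N=T$, $\tau_n=t^{n+1}-t^n$, and $u_h^n\in V_h$. A one-step thermodynamic potential is a map assigning to $(u_h^n,u_h^{n+1})$ an element $\overline\mu_h^{\,n+\frac12}\in V_h$ such that $$\bigl(\overline\mu_h^{\,n+\frac12},u_h^{n+1}-u_h^n\bigr)_{L^2}=\mathcal F_h[u_h^{n+1}]-\mathcal F_h[u_h^n].$$ A one-step scheme is $$\left(\frac{u_h^{n+1}-u_h^n}{\tau_n},\varphi_h\right)_{L^2}+a_{h,\tau}^{\mathrm{rev}}(u_h^n,u_h^{n+1};\varphi_h)+a_{h,\tau}^{\mathrm{diss}}(u_h^n,u_h^{n+1};\varphi_h)=\ell_{R,h,\tau}(u_h^n,u_h^{n+1};\varphi_h)+\ell_{\partial,h,\tau}(u_h^n,u_h^{n+1};\varphi_h)$$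 for all $\varphi_h\in V_h$, with given real-valued forms $a_{h,\tau}^{\mathrm{rev}},a_{h,\tau}^{\mathrm{diss}},\ell_{R,h,\tau},\ell_{\partial,h,\tau}$. It is thermodynamically admissible if testing with $\overline\mu_h^{\,n+\frac12}$ yields, for real numbers $\mathcal B_{h,\tau}^{\mathrm{rev},n+\frac12},\mathcal B_{h,\tau}^{\mathrm{diss},n+\frac12},\mathcal B_{h,\tau}^{\mathrm{ext},n+\frac12},\mathcal D_{h,\tau}^{\,n+\frac12},\mathcal S_{h,\tau}^{\,n+\frac12}$: $a_{h,\tau}^{\mathrm{rev}}(u_h^n,u_h^{n+1};\overline\mu_h^{\,n+\frac12})=-\mathcal B_{h,\tau}^{\mathrm{rev},\,n+\frac12}$; $a_{h,\tau}^{\mathrm{diss}}(u_h^n,u_h^{n+1};\overline\mu_h^{\,n+\frac12})=\mathcal D_{h,\tau}^{\,n+\frac12}-\mathcal B_{h,\tau}^{\mathrm{diss},\,n+\frac12}$ with $\mathcal D_{h,\tau}^{\,n+\frac12}\ge0$; $\ell_{R,h,\tau}(u_h^n,u_h^{n+1};\overline\mu_h^{\,n+\frac12})=\mathcal S_{h,\tau}^{\,n+\frac12}$; $\ell_{\partial,h,\tau}(u_h^n,u_h^{n+1};\overline\mu_h^{\,n+\frac12})=\mathcal B_{h,\tau}^{\mathrm{ext},\,n+\frac12}$. *)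

theory Defs
  imports "HOL-Analysis.Analysis"
begin

text \<open>
  In a suitable orthonormal frame, \<open>\<Omega>\<close> is near each boundary point the strict epigraph of a
  Lipschitz function: \<open>e\<close> is the vertical axis of the frame, \<open>x - (x \<bullet> e) *\<^sub>R e\<close> the horizontal part.
\<close>

definition bounded_Lipschitz_domain :: "'a::euclidean_space set \<Rightarrow> bool" where
  "bounded_Lipschitz_domain \<Omega> \<longleftrightarrow>
     open \<Omega> \<and> connected \<Omega> \<and> \<Omega> \<noteq> {} \<and> bounded \<Omega> \<and>
     (\<forall>p \<in> frontier \<Omega>. \<exists>U e g L. open U \<and> p \<in> U \<and> norm e = 1 \<and>
        L-lipschitz_on {y. y \<bullet> e = 0} g \<and>
        \<Omega> \<inter> U = {x \<in> U. g (x - (x \<bullet> e) *\<^sub>R e) < x \<bullet> e})"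

text \<open>
  Elements of \<open>L\<^sup>2(\<Omega>; F)\<close> are handled through representatives; equality in \<open>L\<^sup>2\<close> is equality
  almost everywhere on \<open>\<Omega>\<close>.
\<close>

definition L2_functions :: "'a::euclidean_space set \<Rightarrow> ('a \<Rightarrow> 'b::euclidean_space) set" where
  "L2_functions \<Omega> = {f. f \<in> borel_measurable (lebesgue_on \<Omega>) \<and>
                        integrable (lebesgue_on \<Omega>) (\<lambda>x. (norm (f x))\<^sup>2)}"

definition L2_inner ::
    "'a::euclidean_space set \<Rightarrow> ('a \<Rightarrow> 'b::euclidean_space) \<Rightarrow> ('a \<Rightarrow> 'b) \<Rightarrow> real" where
  "L2_inner \<Omega> f g = (LINT x|lebesgue_on \<Omega>. f x \<bullet> g x)"

definition L2_norm :: "'a::euclidean_space set \<Rightarrow> ('a \<Rightarrow> 'b::euclidean_space) \<Rightarrow> real" where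
  "L2_norm \<Omega> f = sqrt (L2_inner \<Omega> f f)"

text \<open>
  \<open>J v\<close> is a representative of the image of \<open>v\<close> under a bounded linear injection of the space of
  all \<open>v\<close> into \<open>L\<^sup>2(\<Omega>; F)\<close>.
\<close>

definition L2_embedding ::
    "'a::euclidean_space set \<Rightarrow> ('v::real_normed_vector \<Rightarrow> 'a \<Rightarrow> 'b::euclidean_space) \<Rightarrow> bool" where
  "L2_embedding \<Omega> J \<longleftrightarrow>
     (\<forall>v. J v \<in> L2_functions \<Omega>) \<and>
     (\<forall>v w. AE x in lebesgue_on \<Omega>. J (v + w) x = J v x + J w x) \<and>
     (\<forall>c v. AE x in lebesgue_on \<Omega>. J (c *\<^sub>R v) x = c *\<^sub>R J v x) \<and>
     (\<forall>v. (AE x in lebesgue_on \<Omega>. J v x = 0) \<longrightarrow> v = 0) \<and>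
     (\<exists>C. \<forall>v. L2_norm \<Omega> (J v) \<le> C * norm v)"

text \<open>Surjectivity of the canonical map into the bidual.\<close>

definition reflexive_space :: "'v::real_normed_vector itself \<Rightarrow> bool" where
  "reflexive_space _ \<longleftrightarrow>
     (\<forall>\<Phi> :: ('v \<Rightarrow>\<^sub>L real) \<Rightarrow>\<^sub>L real. \<exists>v. \<forall>f. blinfun_apply \<Phi> f = blinfun_apply f v)"

definition finite_dim_subspace :: "'v::real_vector set \<Rightarrow> bool" where
  "finite_dim_subspace W \<longleftrightarrow> (\<exists>B. finite B \<and> W = span B)"

definition time_grid :: "real \<Rightarrow> nat \<Rightarrow> (nat \<Rightarrow> real) \<Rightarrow> bool" where
  "time_grid T N t \<longleftrightarrow> t 0 = 0 \<and> t N = T \<and> (\<forall>n<N. t n < t (Suc n))"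

definition time_step :: "(nat \<Rightarrow> real) \<Rightarrow> nat \<Rightarrow> real" where
  "time_step t n = t (Suc n) - t n"

text \<open>
  Below, \<open>\<mu> (u n) (u (Suc n))\<close> is the potential at the half step \<open>n + 1/2\<close>, and quantities
  attached to that half step are indexed by \<open>n\<close>.  The conditions concern the steps \<open>n < N\<close> of the
  given discrete evolution \<open>u\<close>.
\<close>

definition one_step_potential ::
    "'a::euclidean_space set \<Rightarrow> ('v::real_normed_vector \<Rightarrow> 'a \<Rightarrow> 'b::euclidean_space) \<Rightarrow> 'v set \<Rightarrow>
     ('v \<Rightarrow> real) \<Rightarrow> nat \<Rightarrow> (nat \<Rightarrow> 'v) \<Rightarrow> ('v \<Rightarrow> 'v \<Rightarrow> 'v) \<Rightarrow> bool" where
  "one_step_potential \<Omega> J V\<^sub>h F N u \<mu> \<longleftrightarrow>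
     (\<forall>n<N. \<mu> (u n) (u (Suc n)) \<in> V\<^sub>h \<and>
        L2_inner \<Omega> (J (\<mu> (u n) (u (Suc n)))) (J (u (Suc n) - u n)) = F (u (Suc n)) - F (u n))"

text \<open>
  The first argument of a form is the current step size; the last one is the test function.
\<close>

type_synonym 'v step_form = "real \<Rightarrow> 'v \<Rightarrow> 'v \<Rightarrow> 'v \<Rightarrow> real"

definition one_step_scheme ::
    "'a::euclidean_space set \<Rightarrow> ('v::real_normed_vector \<Rightarrow> 'a \<Rightarrow> 'b::euclidean_space) \<Rightarrow> 'v set \<Rightarrow>
     nat \<Rightarrow> (nat \<Rightarrow> real) \<Rightarrow> 'v step_form \<Rightarrow> 'v step_form \<Rightarrow> 'v step_form \<Rightarrow> 'v step_form \<Rightarrow>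
     (nat \<Rightarrow> 'v) \<Rightarrow> bool" where
  "one_step_scheme \<Omega> J V\<^sub>h N t a_rev a_diss l_R l_bd u \<longleftrightarrow>
     (\<forall>n<N. \<forall>\<phi>\<in>V\<^sub>h.
        L2_inner \<Omega> (J ((u (Suc n) - u n) /\<^sub>R time_step t n)) (J \<phi>)
        + a_rev (time_step t n) (u n) (u (Suc n)) \<phi>
        + a_diss (time_step t n) (u n) (u (Suc n)) \<phi>
        = l_R (time_step t n) (u n) (u (Suc n)) \<phi>
        + l_bd (time_step t n) (u n) (u (Suc n)) \<phi>)"

definition thermodynamically_admissible ::
    "nat \<Rightarrow> (nat \<Rightarrow> real) \<Rightarrow> 'v step_form \<Rightarrow> 'v step_form \<Rightarrow> 'v step_form \<Rightarrow> 'v step_form \<Rightarrow>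
     (nat \<Rightarrow> 'v) \<Rightarrow> ('v \<Rightarrow> 'v \<Rightarrow> 'v) \<Rightarrow>
     (nat \<Rightarrow> real) \<Rightarrow> (nat \<Rightarrow> real) \<Rightarrow> (nat \<Rightarrow> real) \<Rightarrow> (nat \<Rightarrow> real) \<Rightarrow> (nat \<Rightarrow> real) \<Rightarrow> bool" where
  "thermodynamically_admissible N t a_rev a_diss l_R l_bd u \<mu> B_rev B_diss B_ext D S \<longleftrightarrow>
     (\<forall>n<N. let \<tau> = time_step t n; v = u n; w = u (Suc n) in
        a_rev \<tau> v w (\<mu> v w) = - B_rev n \<and>
        a_diss \<tau> v w (\<mu> v w) = D n - B_diss n \<and> D n \<ge> 0 \<and>
        l_R \<tau> v w (\<mu> v w) = S n \<and>
        l_bd \<tau> v w (\<mu> v w) = B_ext n)"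

end

theory Submission
  imports Defs
begin

text \<open>
  Testing the scheme with the half-step potential turns the four forms into the four prescribed
  numbers, while the difference quotient contributes its \<open>L\<^sup>2\<close> pairing with the potential.  By
  homogeneity and symmetry of the \<open>L\<^sup>2\<close> pairing this is \<open>1 / \<tau>\<close> times the free-energy increment,
  exactly (not just up to a consistency error), because the potential is a discrete gradient.
  Multiplying by the nonzero step size \<open>\<tau>\<close> gives the balance.  As vectors enter the pairing only
  through representatives, which respect scaling merely almost everywhere, homogeneity
  (\<open>L2_inner_embedding_scaleR\<close>) is a statement about integrals.
\<close>

lemma L2_inner_commute: "L2_inner \<Omega> f g = L2_inner \<Omega> g f"
  unfolding L2_inner_def by (simp add: inner_commute)

lemma L2_embedding_measurable:
  "L2_embedding \<Omega> J \<Longrightarrow> J v \<in> borel_measurable (lebesgue_on \<Omega>)"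
  unfolding L2_embedding_def L2_functions_def by blast

text \<open>
  The representatives \<open>J (c *\<^sub>R v)\<close> and \<open>c *\<^sub>R J v\<close> may differ on a null set, which the integral
  does not see.
\<close>

lemma L2_inner_embedding_scaleR:
  assumes J: "L2_embedding \<Omega> J"
  shows "L2_inner \<Omega> (J (c *\<^sub>R v)) (J w) = c * L2_inner \<Omega> (J v) (J w)"
proof -
  note [measurable] = L2_embedding_measurable[OF J]
  have "AE x in lebesgue_on \<Omega>. J (c *\<^sub>R v) x = c *\<^sub>R J v x"
    using J unfolding L2_embedding_def by blast
  then have "L2_inner \<Omega> (J (c *\<^sub>R v)) (J w) = (LINT x|lebesgue_on \<Omega>. c * (J v x \<bullet> J w x))"
    unfolding L2_inner_def by (intro integral_cong_AE) auto
  then show ?thesis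
    unfolding L2_inner_def by simp
qed

theorem theorem7p7:
  fixes \<Omega> :: "(real ^ 'd) set"
    and J :: "'v::banach \<Rightarrow> real ^ 'd \<Rightarrow> real ^ 'm"
    and V\<^sub>h :: "'v set"
    and F\<^sub>h :: "'v \<Rightarrow> real"
    and T :: real and N :: nat and t :: "nat \<Rightarrow> real"
    and u :: "nat \<Rightarrow> 'v"
    and \<mu> :: "'v \<Rightarrow> 'v \<Rightarrow> 'v"
    and a_rev a_diss l_R l_bd :: "'v step_form"
    and B_rev B_diss B_ext D S :: "nat \<Rightarrow> real"
  assumes "bounded_Lipschitz_domain \<Omega>"
    and "reflexive_space TYPE('v)"
    and "L2_embedding \<Omega> J"
    and "finite_dim_subspace V\<^sub>h"
    and "time_grid T N t"
    and "\<forall>n\<le>N. u n \<in> V\<^sub>h"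
    and "one_step_potential \<Omega> J V\<^sub>h F\<^sub>h N u \<mu>"
    and "one_step_scheme \<Omega> J V\<^sub>h N t a_rev a_diss l_R l_bd u"
    and "thermodynamically_admissible N t a_rev a_diss l_R l_bd u \<mu> B_rev B_diss B_ext D S"
  shows "\<forall>n<N. F\<^sub>h (u (Suc n)) - F\<^sub>h (u n) =
           - time_step t n * D n
           + time_step t n * (B_rev n + B_diss n + B_ext n)
           + time_step t n * S n"
proof (intro allI impI)
  fix n
  assume n: "n < N"
  let ?\<tau> = "time_step t n" and ?m = "\<mu> (u n) (u (Suc n))"
  have \<tau>: "?\<tau> \<noteq> 0"
    using \<open>time_grid T N t\<close> n unfolding time_grid_def time_step_def by fastforce
  have m: "?m \<in> V\<^sub>h"
    and increment: "L2_inner \<Omega> (J ?m) (J (u (Suc n) - u n)) = F\<^sub>h (u (Suc n)) - F\<^sub>h (u n)"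
    using \<open>one_step_potential \<Omega> J V\<^sub>h F\<^sub>h N u \<mu>\<close> n unfolding one_step_potential_def by auto
  have "L2_inner \<Omega> (J ((u (Suc n) - u n) /\<^sub>R ?\<tau>)) (J ?m)
      = (F\<^sub>h (u (Suc n)) - F\<^sub>h (u n)) / ?\<tau>"
    using L2_inner_embedding_scaleR[OF \<open>L2_embedding \<Omega> J\<close>] L2_inner_commute increment
    by (metis divide_inverse_commute)
  moreover have "L2_inner \<Omega> (J ((u (Suc n) - u n) /\<^sub>R ?\<tau>)) (J ?m)
      + a_rev ?\<tau> (u n) (u (Suc n)) ?m + a_diss ?\<tau> (u n) (u (Suc n)) ?m
      = l_R ?\<tau> (u n) (u (Suc n)) ?m + l_bd ?\<tau> (u n) (u (Suc n)) ?m"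
    using \<open>one_step_scheme \<Omega> J V\<^sub>h N t a_rev a_diss l_R l_bd u\<close> n m
    unfolding one_step_scheme_def by blast
  moreover have "a_rev ?\<tau> (u n) (u (Suc n)) ?m = - B_rev n"
    "a_diss ?\<tau> (u n) (u (Suc n)) ?m = D n - B_diss n"
    "l_R ?\<tau> (u n) (u (Suc n)) ?m = S n"
    "l_bd ?\<tau> (u n) (u (Suc n)) ?m = B_ext n"
    using assms(9) n unfolding thermodynamically_admissible_def Let_def by auto
  ultimately have "(F\<^sub>h (u (Suc n)) - F\<^sub>h (u n)) / ?\<tau>
      = - D n + (B_rev n + B_diss n + B_ext n) + S n"
    by simp
  then have "F\<^sub>h (u (Suc n)) - F\<^sub>h (u n)
      = (- D n + (B_rev n + B_diss n + B_ext n) + S n) * ?\<tau>"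
    using \<tau> by (metis nonzero_divide_eq_eq)
  then show "F\<^sub>h (u (Suc n)) - F\<^sub>h (u n) = - ?\<tau> * D n
      + ?\<tau> * (B_rev n + B_diss n + B_ext n) + ?\<tau> * S n"
    by (simp add: algebra_simps)
qed

end
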